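(* Let $A$ be a C*-algebra that has polar decomposition. Then for all projections $p,q\in A$, $$p\sim_{\mathrm{MvN}}q\iff pAp\sim qAq\qquad\text{and}\qquad p\precsim_{\mathrm{MvN}}q\iff pAp\precsim qAq .$$
   Context: For $a,b\in A$ write $a\perp b$ if $ab=0=ab^*$, and for $S\subseteq A$ put $S^\perp=\{b\in A:s\perp b\text{ for all }s\in S\}$. An annihilator of $A$ is a set of the form $S^\perp$, $S\subseteq A$; $[A]^\perp$ is the set of annihilators. For a projection $p\in A$, $pAp=\{p\}^{\perp\perp}$ is an annihilator. Annihilators $B,C\in[A]^\perp$ are equivalent, $B\sim C$, if there is $a\in A$ with $\{a\}^{\perp\perp}=B$ and $\{a^*\}^{\perp\perp}=C$; and $B\precsim C$ if $B\sim D\subseteq C$ for some $D\in[A]^\perp$. For projections $p,q\in A$, $p\sim_{\mathrm{MvN}}q$ means there is $u\in A$ with $u^*u=p$ and $uu^*=q$, and $p\precsim_{\mathrm{MvN}}q$ means $p\sim_{\mathrm{MvN}}r\le q$ for some projection $r\in A$. $A$ has polar decomposition if for every $a\in A$ there is a partial isometry $u\in A$ with $a=u|a|$, where $|a|=\sqrt{a^*a}$. *)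

theory Defs
  imports "HOL-Analysis.Analysis"
begin

text \<open>
  C*-algebras as a type class: complex Banach algebras with a conjugate-linear, anti-multiplicative
  involution satisfying the C*-identity.  There is no unit among the operations, so the algebra may
  or may not be unital.  The real scalar multiplication inherited from \<open>banach\<close> is required to be
  the restriction of the complex one; homogeneity of the norm for complex scalars is \<open>norm_scaleC\<close>.
\<close>

class cstar_algebra = real_normed_algebra + banach +
  fixes scaleC :: "complex \<Rightarrow> 'a \<Rightarrow> 'a"  (infixr "*\<^sub>C" 75)
    and star :: "'a \<Rightarrow> 'a"  ("(_\<^sup>\<star>)" [1000] 999)
  assumes scaleC_of_real: "complex_of_real r *\<^sub>C x = r *\<^sub>R x"
    and scaleC_add_right: "c *\<^sub>C (x + y) = c *\<^sub>C x + c *\<^sub>C y"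
    and scaleC_add_left: "(c + d) *\<^sub>C x = c *\<^sub>C x + d *\<^sub>C x"
    and scaleC_scaleC: "c *\<^sub>C (d *\<^sub>C x) = (c * d) *\<^sub>C x"
    and mult_scaleC_left: "(c *\<^sub>C x) * y = c *\<^sub>C (x * y)"
    and mult_scaleC_right: "x * (c *\<^sub>C y) = c *\<^sub>C (x * y)"
    and norm_scaleC: "norm (c *\<^sub>C x) = cmod c * norm x"
    and star_star: "(x\<^sup>\<star>)\<^sup>\<star> = x"
    and star_add: "(x + y)\<^sup>\<star> = x\<^sup>\<star> + y\<^sup>\<star>"
    and star_scaleC: "(c *\<^sub>C x)\<^sup>\<star> = cnj c *\<^sub>C x\<^sup>\<star>"
    and star_mult: "(x * y)\<^sup>\<star> = y\<^sup>\<star> * x\<^sup>\<star>"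
    and cstar_identity: "norm (x\<^sup>\<star> * x) = (norm x)\<^sup>2"

definition perp :: "'a::cstar_algebra \<Rightarrow> 'a \<Rightarrow> bool"  (infix "\<bottom>\<^sub>A" 50)
  where "a \<bottom>\<^sub>A b \<longleftrightarrow> a * b = 0 \<and> a * b\<^sup>\<star> = 0"

definition ann :: "'a::cstar_algebra set \<Rightarrow> 'a set"
  where "ann S = {b. \<forall>s\<in>S. s \<bottom>\<^sub>A b}"

definition annihilators :: "'a::cstar_algebra set set"
  where "annihilators = range ann"

text \<open>
  Equivalence and subequivalence are used only for annihilators; equivalent sets are automatically
  annihilators, being of the form \<open>ann (ann {a})\<close>.
\<close>

definition ann_equiv :: "'a::cstar_algebra set \<Rightarrow> 'a set \<Rightarrow> bool"  (infix "\<sim>\<^sub>A" 50)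
  where "B \<sim>\<^sub>A C \<longleftrightarrow> (\<exists>a. ann (ann {a}) = B \<and> ann (ann {a\<^sup>\<star>}) = C)"

definition ann_subequiv :: "'a::cstar_algebra set \<Rightarrow> 'a set \<Rightarrow> bool"  (infix "\<lesssim>\<^sub>A" 50)
  where "B \<lesssim>\<^sub>A C \<longleftrightarrow> (\<exists>D\<in>annihilators. B \<sim>\<^sub>A D \<and> D \<subseteq> C)"

definition projection :: "'a::cstar_algebra \<Rightarrow> bool"
  where "projection p \<longleftrightarrow> p\<^sup>\<star> = p \<and> p * p = p"

text \<open>On projections the order of self-adjoint elements (\<open>q - r\<close> positive) is \<open>r * q = r\<close>.\<close>

definition proj_le :: "'a::cstar_algebra \<Rightarrow> 'a \<Rightarrow> bool"  (infix "\<le>\<^sub>P" 50)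
  where "r \<le>\<^sub>P q \<longleftrightarrow> r * q = r"

definition mvn_equiv :: "'a::cstar_algebra \<Rightarrow> 'a \<Rightarrow> bool"  (infix "\<sim>\<^sub>M\<^sub>v\<^sub>N" 50)
  where "p \<sim>\<^sub>M\<^sub>v\<^sub>N q \<longleftrightarrow> (\<exists>u. u\<^sup>\<star> * u = p \<and> u * u\<^sup>\<star> = q)"

definition mvn_subequiv :: "'a::cstar_algebra \<Rightarrow> 'a \<Rightarrow> bool"  (infix "\<lesssim>\<^sub>M\<^sub>v\<^sub>N" 50)
  where "p \<lesssim>\<^sub>M\<^sub>v\<^sub>N q \<longleftrightarrow> (\<exists>r. projection r \<and> p \<sim>\<^sub>M\<^sub>v\<^sub>N r \<and> r \<le>\<^sub>P q)"

definition corner :: "'a::cstar_algebra \<Rightarrow> 'a set"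
  where "corner p = {p * a * p | a. True}"

definition partial_isometry :: "'a::cstar_algebra \<Rightarrow> bool"
  where "partial_isometry u \<longleftrightarrow> projection (u\<^sup>\<star> * u)"

definition positive :: "'a::cstar_algebra \<Rightarrow> bool"
  where "positive h \<longleftrightarrow> (\<exists>b. h = b\<^sup>\<star> * b)"

text \<open>
  \<open>is_sqrt h b\<close> says that \<open>h\<close> is the positive square root of \<open>b\<close>.  In a C*-algebra every positive
  element has exactly one positive square root; the relational form avoids a description operator.
\<close>

definition is_sqrt :: "'a::cstar_algebra \<Rightarrow> 'a \<Rightarrow> bool"
  where "is_sqrt h b \<longleftrightarrow> positive h \<and> h * h = b"

text \<open>
  In the next definition \<open>h\<close> is \<open>|a|\<close>, the positive square root of \<open>a\<^sup>\<star> * a\<close>.  The property concerns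
  the whole algebra, that is, the type \<open>'a\<close>, hence the type argument.
\<close>

definition has_polar_decomposition :: "'a::cstar_algebra itself \<Rightarrow> bool"
  where "has_polar_decomposition _ \<longleftrightarrow>
    (\<forall>a::'a. \<exists>u h. partial_isometry u \<and> is_sqrt h (a\<^sup>\<star> * a) \<and> a = u * h)"

end

theory Submission
  imports Defs
begin

text \<open>
  The set \<open>ann (ann {a})\<close> carries exactly the same information as the right annihilator
  \<open>{x. a * x = 0}\<close> (\<open>ann_ann_eq_iff\<close>), and \<open>corner p\<close> is \<open>ann (ann {p})\<close> for a projection \<open>p\<close>
  (\<open>corner_eq_ann_ann\<close>).  So both relations on corners become statements about which elements
  annihilate the same \<open>x\<close>.  Multiplying by \<open>u\<^sup>\<star>\<close> does not enlarge the right annihilator of \<open>u\<close>,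
  hence \<open>u\<close> and \<open>u\<^sup>\<star> * u\<close> generate the same annihilator; a partial isometry that implements
  \<open>p \<sim>\<^sub>M\<^sub>v\<^sub>N q\<close> therefore also implements \<open>corner p \<sim>\<^sub>A corner q\<close>.

  For the converse, let \<open>a\<close> generate \<open>corner p\<close> and write \<open>a = u * h\<close> with \<open>h = \<bar>a\<bar>\<close>.  Then
  \<open>h\<close> and \<open>p\<close> annihilate the same elements on the right.  The initial projection \<open>u\<^sup>\<star> * u\<close> acts as
  a unit on \<open>h\<close>, hence it acts as a unit on \<open>p\<close>.  Cutting \<open>u\<close> down to \<open>v = u * p\<close> gives
  \<open>v\<^sup>\<star> * v = p\<close>, and since \<open>a\<^sup>\<star> = h * u\<^sup>\<star>\<close>, the adjoint \<open>a\<^sup>\<star>\<close> annihilates the same elements as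
  \<open>p * u\<^sup>\<star> = v\<^sup>\<star>\<close>, that is, as \<open>v * v\<^sup>\<star>\<close>.  Thus \<open>ann (ann {a\<^sup>\<star>})\<close> is the corner of \<open>v * v\<^sup>\<star>\<close>, a
  projection equivalent to \<open>p\<close> (\<open>polar_decomposition_corner\<close>).  A projection is
  determined by its corner, and inclusion of corners is the order of projections, so this one
  construction settles both converses.
\<close>

section \<open>Cancellation from the C*-identity\<close>

lemma star_zero [simp]: "(0::'a::cstar_algebra)\<^sup>\<star> = 0"
  using star_add[of "0::'a" 0] by simp

lemma star_minus: "(- x)\<^sup>\<star> = - (x\<^sup>\<star>)" for x :: "'a::cstar_algebra"
proof -
  have "x\<^sup>\<star> + (- x)\<^sup>\<star> = 0" using star_add[of x "- x"] by simp
  then show ?thesis by (metis minus_unique)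
qed

lemma star_diff: "(x - y)\<^sup>\<star> = x\<^sup>\<star> - y\<^sup>\<star>" for x y :: "'a::cstar_algebra"
  using star_add[of x "- y"] by (simp add: star_minus)

lemma star_eq_0_iff [simp]: "x\<^sup>\<star> = 0 \<longleftrightarrow> x = 0" for x :: "'a::cstar_algebra"
  by (metis star_star star_zero)

lemma star_mult_self_eq_0_iff: "x\<^sup>\<star> * x = 0 \<longleftrightarrow> x = 0" for x :: "'a::cstar_algebra"
  using cstar_identity[of x] by auto

lemma mult_star_self_eq_0_iff: "x * x\<^sup>\<star> = 0 \<longleftrightarrow> x = 0" for x :: "'a::cstar_algebra"
  using star_mult_self_eq_0_iff[of "x\<^sup>\<star>"] by (simp add: star_star)

text \<open>If \<open>x\<^sup>\<star> * x * y = 0\<close>, then \<open>(x * y)\<^sup>\<star> * (x * y) = 0\<close>, and the C*-identity applies.\<close>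

lemma star_mult_mult_eq_0_iff: "x\<^sup>\<star> * x * y = 0 \<longleftrightarrow> x * y = 0" for x y :: "'a::cstar_algebra"
proof
  assume "x\<^sup>\<star> * x * y = 0"
  then have "y\<^sup>\<star> * (x\<^sup>\<star> * x * y) = 0" by simp
  then have "(x * y)\<^sup>\<star> * (x * y) = 0" by (simp add: star_mult mult.assoc)
  then show "x * y = 0" by (simp add: star_mult_self_eq_0_iff)
qed (simp add: mult.assoc)

lemma mult_mult_star_eq_0_iff: "y * x * x\<^sup>\<star> = 0 \<longleftrightarrow> y * x = 0" for x y :: "'a::cstar_algebra"
proof
  assume "y * x * x\<^sup>\<star> = 0"
  then have "(y * x) * (y * x)\<^sup>\<star> = 0" by (simp add: star_mult mult.assoc [symmetric])
  then show "y * x = 0" by (simp add: mult_star_self_eq_0_iff)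
qed simp

text \<open>
  The defect \<open>d = u * (u\<^sup>\<star> * u) - u\<close> satisfies \<open>u\<^sup>\<star> * d = 0\<close>, so \<open>d\<^sup>\<star> * d = 0\<close> and
  \<open>u * u\<^sup>\<star> * u = u\<close>.
\<close>

lemma projection_mult_star:
  assumes "projection (u\<^sup>\<star> * u)"
  shows "projection (u * u\<^sup>\<star>)"
proof -
  let ?d = "u * (u\<^sup>\<star> * u) - u"
  have e: "u\<^sup>\<star> * (u * (u\<^sup>\<star> * u)) = u\<^sup>\<star> * u"
    using assms by (simp add: projection_def mult.assoc)
  then have "u\<^sup>\<star> * ?d = 0" by (simp add: right_diff_distrib)
  moreover have "?d\<^sup>\<star> * ?d = (u\<^sup>\<star> * u) * (u\<^sup>\<star> * ?d) - u\<^sup>\<star> * ?d"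
    by (simp add: star_diff star_mult star_star left_diff_distrib mult.assoc)
  ultimately have "?d = 0" using star_mult_self_eq_0_iff[of ?d] by simp
  then have u: "u * (u\<^sup>\<star> * u) = u" by simp
  have "u * u\<^sup>\<star> * (u * u\<^sup>\<star>) = u * (u\<^sup>\<star> * u) * u\<^sup>\<star>" by (simp only: mult.assoc)
  also have "\<dots> = u * u\<^sup>\<star>" by (simp only: u)
  finally show ?thesis
    by (simp add: projection_def star_mult star_star)
qed

lemma mult_projection_of_right_annihilator:
  fixes e :: "'a::cstar_algebra"
  assumes "projection e" and "\<And>x. e * x = 0 \<Longrightarrow> b * x = 0"
  shows "b * e = b"
proof -
  \<comment> \<open>Without a unit, the role of \<open>1 - e\<close> is played by the elements \<open>x - e * x\<close>.\<close>
  have e: "e * (x - e * x) = 0" for x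
    using assms(1) by (simp add: projection_def right_diff_distrib flip: mult.assoc)
  have "b * x = b * e * x" for x
    using assms(2)[OF e[of x]] by (simp add: right_diff_distrib mult.assoc)
  from this[of "(b - b * e)\<^sup>\<star>"] have "(b - b * e) * (b - b * e)\<^sup>\<star> = 0"
    by (simp add: left_diff_distrib)
  then show ?thesis by (simp add: mult_star_self_eq_0_iff)
qed

lemma projection_eqI:
  assumes "projection p" "projection q" "p * q = p" "q * p = q"
  shows "p = q"
proof -
  have "p = (p * q)\<^sup>\<star>" using assms(1,3) by (simp add: projection_def)
  also have "\<dots> = q * p" using assms(1,2) by (simp add: projection_def star_mult)
  finally show ?thesis using assms(4) by simp
qed

section \<open>Annihilators generated by one element\<close>

lemma ann_singleton: "ann {a} = {b. a * b = 0 \<and> a * b\<^sup>\<star> = 0}"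
  by (auto simp: ann_def perp_def)

text \<open>
  The relation \<open>\<bottom>\<^sub>A\<close> is not symmetric, so \<open>a\<close> itself need not lie in \<open>ann (ann {a})\<close>.
  The self-adjoint element \<open>a\<^sup>\<star> * a\<close>, which has the same right annihilator, does.
\<close>

lemma star_mult_self_in_ann_ann: "a\<^sup>\<star> * a \<in> ann (ann {a})"
proof -
  have "c * (a\<^sup>\<star> * a) = 0" if "a * c\<^sup>\<star> = 0" for c
  proof -
    have "c * a\<^sup>\<star> = (a * c\<^sup>\<star>)\<^sup>\<star>" by (simp add: star_mult star_star)
    with that show ?thesis by (simp add: mult.assoc [symmetric])
  qed
  then show ?thesis
    by (auto simp: ann_def perp_def star_mult star_star)
qed

lemma ann_ann_eq_imp:
  fixes a b :: "'a::cstar_algebra"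
  assumes "ann (ann {a}) = ann (ann {b})" and "a * x = 0"
  shows "b * x = 0"
proof -
  \<comment> \<open>Membership in \<open>ann\<close> concerns an element together with its adjoint, so \<open>x\<close> is replaced by \<open>x * x\<^sup>\<star>\<close>.\<close>
  have "x * x\<^sup>\<star> \<in> ann {a}"
    using assms(2) by (simp add: ann_singleton star_mult star_star flip: mult.assoc)
  moreover have "b\<^sup>\<star> * b \<in> ann (ann {a})"
    using star_mult_self_in_ann_ann[of b] assms(1) by simp
  ultimately have "x * x\<^sup>\<star> * (b\<^sup>\<star> * b) = 0"
    by (auto simp: ann_def perp_def)
  then have "(x * x\<^sup>\<star> * (b\<^sup>\<star> * b))\<^sup>\<star> = 0" by simp
  then have "b\<^sup>\<star> * b * (x * x\<^sup>\<star>) = 0" by (simp add: star_mult star_star)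
  then have "b * x * x\<^sup>\<star> = 0"
    by (simp only: star_mult_mult_eq_0_iff mult.assoc [of b])
  then show ?thesis by (simp add: mult_mult_star_eq_0_iff)
qed

lemma ann_ann_eq_iff:
  "ann (ann {a}) = ann (ann {b}) \<longleftrightarrow> (\<forall>x. a * x = 0 \<longleftrightarrow> b * x = 0)"
proof
  assume "ann (ann {a}) = ann (ann {b})"
  then show "\<forall>x. a * x = 0 \<longleftrightarrow> b * x = 0" by (metis ann_ann_eq_imp)
next
  assume "\<forall>x. a * x = 0 \<longleftrightarrow> b * x = 0"
  then have "ann {a} = ann {b}" by (simp only: ann_singleton)
  then show "ann (ann {a}) = ann (ann {b})" by (rule arg_cong)
qed

lemma ann_ann_star_mult_self: "ann (ann {a\<^sup>\<star> * a}) = ann (ann {a})"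
  by (simp add: ann_ann_eq_iff star_mult_mult_eq_0_iff)

section \<open>Corners of projections\<close>

text \<open>
  Elements of \<open>ann (ann {p})\<close> are fixed by \<open>p\<close> on the left: the defect \<open>y = x - p * x\<close> gives an
  element \<open>y * y\<^sup>\<star>\<close> of \<open>ann {p}\<close>, which must annihilate \<open>x\<close> and hence \<open>y\<close>.
  As the adjoint also lies in \<open>ann (ann {p})\<close>, they are fixed on the right as well.
\<close>

lemma corner_eq_ann_ann:
  assumes "projection p"
  shows "corner p = ann (ann {p})"
proof
  have p0: "p\<^sup>\<star> = p" "p * p = p" using assms by (simp_all only: projection_def)
  have p1: "p * (p * z) = p * z" for z by (simp only: p0 flip: mult.assoc)
  note p = p0 p1
  show "corner p \<subseteq> ann (ann {p})"
  proof
    fix x assume "x \<in> corner p"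
    then obtain y where x: "x = p * y * p" by (auto simp: corner_def)
    have "c * (p * z) = 0" if "p * c\<^sup>\<star> = 0" for c z
    proof -
      have "c * p = (p * c\<^sup>\<star>)\<^sup>\<star>" by (simp add: star_mult star_star p)
      with that show ?thesis by (simp flip: mult.assoc)
    qed
    then show "x \<in> ann (ann {p})"
      by (auto simp: x ann_singleton ann_def[of "Collect _"] perp_def star_mult p mult.assoc)
  qed
  have left: "p * x = x" if x: "\<And>c. c \<in> ann {p} \<Longrightarrow> c * x = 0" for x
  proof -
    define y where "y = x - p * x"
    have "p * y = 0" by (simp add: y_def right_diff_distrib p)
    moreover have "y\<^sup>\<star> * p = (p * y)\<^sup>\<star>" by (simp add: star_mult p)
    ultimately have py: "p * y = 0" "y\<^sup>\<star> * p = 0" by simp_all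
    then have "y * y\<^sup>\<star> \<in> ann {p}"
      by (simp add: ann_singleton star_mult star_star flip: mult.assoc)
    then have "y * y\<^sup>\<star> * x = 0" by (rule x)
    moreover have "y * y\<^sup>\<star> * (p * x) = 0"
      by (metis py(2) mult.assoc mult_zero_left mult_zero_right)
    ultimately have "y * y\<^sup>\<star> * y = 0"
      by (simp add: y_def right_diff_distrib)
    then have "y = 0"
      using star_mult_mult_eq_0_iff[of "y\<^sup>\<star>" y] by (simp add: star_star star_mult_self_eq_0_iff)
    then show ?thesis by (simp add: y_def)
  qed
  show "ann (ann {p}) \<subseteq> corner p"
  proof
    fix x assume "x \<in> ann (ann {p})"
    then have "p * x = x" and "p * x\<^sup>\<star> = x\<^sup>\<star>"
      by (auto intro!: left simp: ann_def[of "ann _"] perp_def)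
    then have "x = p * x * p" by (metis p(1) star_mult star_star)
    then show "x \<in> corner p" by (auto simp: corner_def)
  qed
qed

lemma corner_mono_imp_proj_le:
  assumes "projection r" "projection q" "corner r \<subseteq> corner q"
  shows "r \<le>\<^sub>P q"
proof -
  have "r = r * r * r" using assms(1) by (simp add: projection_def)
  then have "r \<in> corner q" using assms(3) unfolding corner_def by blast
  then obtain y where "r = q * y * q" by (auto simp: corner_def)
  then show ?thesis using assms(2) by (simp add: proj_le_def projection_def mult.assoc)
qed

lemma proj_le_imp_corner_mono:
  assumes "projection r" "projection q" "r \<le>\<^sub>P q"
  shows "corner r \<subseteq> corner q"
proof -
  have rq: "r * q = r" using assms(3) by (simp add: proj_le_def)
  then have "q * r = r" using assms(1,2) by (metis projection_def star_mult)
  with rq have "r * y * r = q * (r * y * r) * q" for y by (metis mult.assoc)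
  then show ?thesis unfolding corner_def by blast
qed

lemma corner_inj:
  assumes "projection p" "projection q" "corner p = corner q"
  shows "p = q"
proof (rule projection_eqI[OF assms(1,2)])
  show "p * q = p" "q * p = q"
    using assms corner_mono_imp_proj_le[of p q] corner_mono_imp_proj_le[of q p]
    by (simp_all add: proj_le_def)
qed

section \<open>Murray-von Neumann equivalence and equivalence of corners\<close>

lemma mvn_equiv_imp_ann_equiv:
  assumes "projection p" "projection q" "p \<sim>\<^sub>M\<^sub>v\<^sub>N q"
  shows "corner p \<sim>\<^sub>A corner q"
proof -
  obtain u where "u\<^sup>\<star> * u = p" "u * u\<^sup>\<star> = q" using assms(3) by (auto simp: mvn_equiv_def)
  then have "ann (ann {u}) = corner p" "ann (ann {u\<^sup>\<star>}) = corner q"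
    using ann_ann_star_mult_self[of u] ann_ann_star_mult_self[of "u\<^sup>\<star>"] assms
    by (simp_all add: corner_eq_ann_ann star_star)
  then show ?thesis by (auto simp: ann_equiv_def)
qed

text \<open>
  The partial isometry in a polar decomposition may have an initial projection larger than the
  support of \<open>a\<close>; multiplying it by \<open>p\<close> on the right brings the initial projection down to \<open>p\<close>.
\<close>

lemma polar_decomposition_corner:
  fixes a :: "'a::cstar_algebra"
  assumes "has_polar_decomposition TYPE('a)" "projection p" "ann (ann {a}) = corner p"
  obtains r where "projection r" "p \<sim>\<^sub>M\<^sub>v\<^sub>N r" "ann (ann {a\<^sup>\<star>}) = corner r"
proof -
  obtain u h where u: "projection (u\<^sup>\<star> * u)" and h: "positive h" "h * h = a\<^sup>\<star> * a"
    and a: "a = u * h"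
    using assms(1) unfolding has_polar_decomposition_def partial_isometry_def is_sqrt_def by blast
  have hs: "h\<^sup>\<star> = h" using h(1) by (auto simp: positive_def star_mult star_star)
  have ps: "p\<^sup>\<star> = p" "p * p = p" using assms(2) by (simp_all add: projection_def)
  have "ann (ann {h}) = ann (ann {a})"
    using ann_ann_star_mult_self[of h] ann_ann_star_mult_self[of a] h(2) hs by simp
  then have hp: "h * x = 0 \<longleftrightarrow> p * x = 0" for x
    using assms(2,3) by (simp add: corner_eq_ann_ann ann_ann_eq_iff)
  \<comment> \<open>The relation \<open>h * e * h = a\<^sup>\<star> * a = h * h\<close> makes \<open>h - e * h\<close> vanish by the C*-identity.\<close>
  define e where "e = u\<^sup>\<star> * u"
  have e: "e\<^sup>\<star> = e" "e * e = e" using u by (simp_all add: e_def projection_def)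
  have "h * (e * h) = h * h" by (simp add: h(2) a star_mult hs e_def mult.assoc)
  moreover have "e * (e * h) = e * h" by (simp add: e flip: mult.assoc)
  ultimately have "(h - e * h)\<^sup>\<star> * (h - e * h) = 0"
    by (simp add: star_diff star_mult hs e left_diff_distrib right_diff_distrib mult.assoc)
  then have "e * h = h" by (simp add: star_mult_self_eq_0_iff)
  then have he: "h * e = h" by (metis star_mult hs e(1))
  have "p * e = p"
  proof (rule mult_projection_of_right_annihilator)
    show "projection e" using u by (simp add: e_def)
    fix x assume "e * x = 0"
    then have "h * x = 0" by (metis he mult.assoc mult_zero_right)
    then show "p * x = 0" by (simp add: hp)
  qed
  then have v: "(u * p)\<^sup>\<star> * (u * p) = p"
    by (simp add: star_mult ps e_def mult.assoc [symmetric])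
  define r where "r = (u * p) * (u * p)\<^sup>\<star>"
  have r: "projection r"
    unfolding r_def using projection_mult_star[of "u * p"] v assms(2) by simp
  have "p \<sim>\<^sub>M\<^sub>v\<^sub>N r" using v by (auto simp: mvn_equiv_def r_def)
  moreover have "ann (ann {a\<^sup>\<star>}) = corner r"
  proof -
    have "ann (ann {a\<^sup>\<star>}) = ann (ann {(u * p)\<^sup>\<star>})"
      by (simp add: ann_ann_eq_iff a star_mult hs ps hp mult.assoc)
    then show ?thesis
      using ann_ann_star_mult_self[of "(u * p)\<^sup>\<star>"] r
      by (simp add: corner_eq_ann_ann r_def star_star)
  qed
  ultimately show ?thesis using r that by blast
qed

theorem proposition3p36:
  fixes p q :: "'a::cstar_algebra"
  assumes "has_polar_decomposition TYPE('a)"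
    and "projection p" and "projection q"
  shows "(p \<sim>\<^sub>M\<^sub>v\<^sub>N q \<longleftrightarrow> corner p \<sim>\<^sub>A corner q) \<and>
         (p \<lesssim>\<^sub>M\<^sub>v\<^sub>N q \<longleftrightarrow> corner p \<lesssim>\<^sub>A corner q)"
proof (intro conjI iffI)
  assume "p \<sim>\<^sub>M\<^sub>v\<^sub>N q"
  with assms show "corner p \<sim>\<^sub>A corner q" by (intro mvn_equiv_imp_ann_equiv)
next
  assume "corner p \<sim>\<^sub>A corner q"
  then obtain a where a: "ann (ann {a}) = corner p" "ann (ann {a\<^sup>\<star>}) = corner q"
    by (auto simp: ann_equiv_def)
  obtain r where "projection r" "p \<sim>\<^sub>M\<^sub>v\<^sub>N r" "ann (ann {a\<^sup>\<star>}) = corner r"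
    using polar_decomposition_corner[OF assms(1,2) a(1)] .
  with a(2) assms(3) show "p \<sim>\<^sub>M\<^sub>v\<^sub>N q" using corner_inj[of r q] by simp
next
  assume "p \<lesssim>\<^sub>M\<^sub>v\<^sub>N q"
  then obtain r where r: "projection r" "p \<sim>\<^sub>M\<^sub>v\<^sub>N r" "r \<le>\<^sub>P q"
    by (auto simp: mvn_subequiv_def)
  have "corner r \<in> annihilators" using r(1) by (simp add: annihilators_def corner_eq_ann_ann)
  with r assms show "corner p \<lesssim>\<^sub>A corner q"
    using mvn_equiv_imp_ann_equiv[of p r] proj_le_imp_corner_mono[of r q]
    by (auto simp: ann_subequiv_def)
next
  assume "corner p \<lesssim>\<^sub>A corner q"
  then obtain a where a: "ann (ann {a}) = corner p" "ann (ann {a\<^sup>\<star>}) \<subseteq> corner q"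
    by (auto simp: ann_subequiv_def ann_equiv_def)
  obtain r where r: "projection r" "p \<sim>\<^sub>M\<^sub>v\<^sub>N r" "ann (ann {a\<^sup>\<star>}) = corner r"
    using polar_decomposition_corner[OF assms(1,2) a(1)] .
  with a(2) assms(3) have "r \<le>\<^sub>P q" using corner_mono_imp_proj_le[of r q] by simp
  with r show "p \<lesssim>\<^sub>M\<^sub>v\<^sub>N q" by (auto simp: mvn_subequiv_def)
qed

end
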